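(* Let $n \ge 1$, $T \ge 1$ and $k \ge 2$ be integers, and let each customer $i \in \{1,\dots,n\}$ have a score $(R_i,F_i,M_i) \in \{1,\dots,T\}^3$. Let $G$ be the weighted customer graph built from these scores and let $G'$ be its reduced graph. Let $f$ and $f_R$ denote the objective functions of the max-$k$-cut problem (BQO) with input $G$ and with input $G'$, respectively (with the same $k$). If $x^*$ is an optimal solution of (BQO) with input $G$ and $x_R^*$ is an optimal solution of (BQO) with input $G'$, then $f(x^* ) = f_R(x_R^* )$.
   Context: Customer graph $G$: $G=(V,E)$ is the simple weighted graph with vertex set $V=\{1,\dots,n\}$ (one vertex per customer). For vertices $i \neq j$ put $w_{ij} = |R_i-R_j| + |F_i-F_j| + |M_i-M_j|$. Vertices $i \ne j$ are joined by an edge $e_{ij}$, of weight $w_{ij}$, exactly when their scores differ (customers with the same score have $w_{ij}=0$ and are not joined by an edge). Problem (BQO): for a simple graph with vertices $1,\dots,n$, edge set $E$ and non-negative edge weights $w_{ij}$, and for an integer $k\ge 2$, maximize $$f(x) = \sum_{e_{ij}\in E} w_{ij}\left(1 - \sum_{l=1}^k x_{il}x_{jl}\right)$$ subject to $\sum_{l=1}^k x_{il} = 1$ for $i=1,\dots,n$ and $x_{il}\in\{0,1\}$ for all $i=1,\dots,n$, $l=1,\dots,k$. Each edge (unordered pair) is counted once. The variable $x_{il}$ equals $1$ iff vertex $i$ is assigned to group $V_l$; groups may be empty. Reduced graph $G'$: for each score that occurs among the customers, all vertices of $G$ with that score are merged into a single vertex of $G'$; thus the vertices of $G'$ are in bijection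 with the distinct scores occurring, and their number is $n' \le n$. If $p \ne q$ are vertices of $G'$ obtained by merging the sets $\{i_1,\dots,i_a\}$ and $\{j_1,\dots,j_b\}$ of vertices of $G$ respectively, then $p$ and $q$ are joined by an edge in $G'$ with weight $$w'_{pq} = \sum_{s=1}^{a}\sum_{r=1}^{b} w_{i_s j_r}.$$ (BQO) with input $G'$ is the problem of maximizing $$f_R(y) = \sum_{\{p,q\}\in E(G')} w'_{pq}\left(1 - \sum_{l=1}^k y_{pl}y_{ql}\right)$$ over $y\in\{0,1\}^{n'\times k}$ subject to $\sum_{l=1}^k y_{pl} = 1$ for each of the $n'$ vertices $p$ of $G'$, where $E(G')$ is the edge set of $G'$ and each edge (unordered pair) is counted once. *)

theory Defs
  imports Complex_Main
begin

text \<open>Weighted graphs on the vertex set \<open>{1..nvert G}\<close>. Edges are two-element vertex sets; the weight of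
  the edge \<open>{i, j}\<close> is \<open>weight G i j = weight G j i\<close>; values of \<open>weight\<close> at non-edges are irrelevant.\<close>

record wgraph =
  nvert :: nat
  edges :: "nat set set"
  weight :: "nat \<Rightarrow> nat \<Rightarrow> real"

definition simple_wgraph :: "wgraph \<Rightarrow> bool" where
  "simple_wgraph G \<longleftrightarrow>
     edges G \<subseteq> {{i, j} | i j. i \<in> {1..nvert G} \<and> j \<in> {1..nvert G} \<and> i \<noteq> j} \<and>
     (\<forall>i j. weight G i j = weight G j i) \<and> (\<forall>i j. weight G i j \<ge> 0)"


subsection \<open>The problem (BQO)\<close>

text \<open>An assignment \<open>x\<close> is a matrix indexed by \<open>{1..nvert G} \<times> {1..k}\<close>. Its entries outside this range
  are unconstrained, and they do not enter the objective of a simple graph.\<close>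

definition bqo_feasible :: "wgraph \<Rightarrow> nat \<Rightarrow> (nat \<Rightarrow> nat \<Rightarrow> real) \<Rightarrow> bool" where
  "bqo_feasible G k x \<longleftrightarrow>
     (\<forall>i\<in>{1..nvert G}. (\<Sum>l=1..k. x i l) = 1) \<and>
     (\<forall>i\<in>{1..nvert G}. \<forall>l\<in>{1..k}. x i l \<in> {0, 1})"

text \<open>The condition \<open>i < j\<close> picks one orientation of every edge, so each edge is counted once.\<close>

definition bqo_objective :: "wgraph \<Rightarrow> nat \<Rightarrow> (nat \<Rightarrow> nat \<Rightarrow> real) \<Rightarrow> real" where
  "bqo_objective G k x =
     (\<Sum>(i, j)\<in>{(i, j). i < j \<and> {i, j} \<in> edges G}. weight G i j * (1 - (\<Sum>l=1..k. x i l * x j l)))"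

definition bqo_optimal :: "wgraph \<Rightarrow> nat \<Rightarrow> (nat \<Rightarrow> nat \<Rightarrow> real) \<Rightarrow> bool" where
  "bqo_optimal G k x \<longleftrightarrow>
     bqo_feasible G k x \<and> (\<forall>y. bqo_feasible G k y \<longrightarrow> bqo_objective G k y \<le> bqo_objective G k x)"


subsection \<open>Customer graph and reduced graph\<close>

definition customer_graph ::
  "nat \<Rightarrow> (nat \<Rightarrow> nat) \<Rightarrow> (nat \<Rightarrow> nat) \<Rightarrow> (nat \<Rightarrow> nat) \<Rightarrow> wgraph" where
  "customer_graph n R F M =
     \<lparr>nvert = n,
      edges = {{i, j} | i j. i \<in> {1..n} \<and> j \<in> {1..n} \<and> (R i, F i, M i) \<noteq> (R j, F j, M j)},
      weight = (\<lambda>i j. \<bar>real (R i) - real (R j)\<bar> + \<bar>real (F i) - real (F j)\<bar>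
                       + \<bar>real (M i) - real (M j)\<bar>)\<rparr>"

text \<open>The sets of customers that are merged: one for each score that occurs.\<close>

definition score_classes ::
  "nat \<Rightarrow> (nat \<Rightarrow> nat) \<Rightarrow> (nat \<Rightarrow> nat) \<Rightarrow> (nat \<Rightarrow> nat) \<Rightarrow> nat set set" where
  "score_classes n R F M =
     {{i \<in> {1..n}. (R i, F i, M i) = s} | s. s \<in> (\<lambda>i. (R i, F i, M i)) ` {1..n}}"

text \<open>A numbering \<open>B\<close> of the score classes by \<open>1, \<dots>, n'\<close>: vertex \<open>p\<close> of the reduced graph arises by
  merging the set \<open>B p\<close> of vertices of the customer graph.\<close>

definition class_numbering ::
  "nat \<Rightarrow> (nat \<Rightarrow> nat) \<Rightarrow> (nat \<Rightarrow> nat) \<Rightarrow> (nat \<Rightarrow> nat) \<Rightarrow> (nat \<Rightarrow> nat set) \<Rightarrow> bool" where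
  "class_numbering n R F M B \<longleftrightarrow>
     bij_betw B {1..card (score_classes n R F M)} (score_classes n R F M)"

definition reduced_graph ::
  "nat \<Rightarrow> (nat \<Rightarrow> nat) \<Rightarrow> (nat \<Rightarrow> nat) \<Rightarrow> (nat \<Rightarrow> nat) \<Rightarrow> (nat \<Rightarrow> nat set) \<Rightarrow> wgraph" where
  "reduced_graph n R F M B =
     (let n' = card (score_classes n R F M) in
     \<lparr>nvert = n',
      edges = {{p, q} | p q. p \<in> {1..n'} \<and> q \<in> {1..n'} \<and> p \<noteq> q},
      weight = (\<lambda>p q. \<Sum>i\<in>B p. \<Sum>j\<in>B q. weight (customer_graph n R F M) i j)\<rparr>)"

lemma simple_customer_graph: "simple_wgraph (customer_graph n R F M)"
  unfolding simple_wgraph_def customer_graph_def by (fastforce simp: abs_minus_commute)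

lemma simple_reduced_graph: "simple_wgraph (reduced_graph n R F M B)"
proof -
  have "(\<Sum>i\<in>B p. \<Sum>j\<in>B q. weight (customer_graph n R F M) i j)
      = (\<Sum>i\<in>B q. \<Sum>j\<in>B p. weight (customer_graph n R F M) i j)" for p q
    by (subst sum.swap) (simp add: customer_graph_def abs_minus_commute)
  moreover have "(\<Sum>i\<in>B p. \<Sum>j\<in>B q. weight (customer_graph n R F M) i j) \<ge> 0" for p q
    by (intro sum_nonneg) (simp add: customer_graph_def)
  ultimately show ?thesis
    unfolding simple_wgraph_def reduced_graph_def Let_def by auto
qed

lemma ex_class_numbering: "\<exists>B. class_numbering n R F M B"
proof -
  have "finite (score_classes n R F M)"
    unfolding score_classes_def Setcompr_eq_image by (intro finite_imageI) (simp del: atLeastAtMost_iff)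
  then show ?thesis
    unfolding class_numbering_def using ex_bij_betw_nat_finite_1 by blast
qed

end

theory Submission
  imports Defs
begin

text \<open>
  Customers with equal scores are twins in the customer graph: they are not adjacent, and every
  other vertex sees them with the same weight. An optimal cut may therefore be taken constant on
  every score class. Indeed, if the rest of the assignment is fixed, each member of a class adds to
  the objective an amount that depends only on its own group, by the same function for all members;
  giving all of them the group of a member whose contribution is largest cannot lower the objective
  (\<open>merge_twin_set\<close>). This is done for one class after the other (\<open>merge_twin_classes\<close>).

  Assignments that are constant on score classes correspond to assignments of the reduced graph, with
  the same objective, because the weights of the reduced graph collect those of the customer
  graph block by block (\<open>bqo_objective_reduced\<close>). So each of the two optimal values bounds the other.

  Both objectives are handled as sums over all ordered pairs of vertices. This counts every edge
  twice and is harmless at non-edges, since in either graph the weight function vanishes there.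
\<close>

section \<open>Making an assignment constant on classes of twins\<close>

definition pair_sum :: "'v set \<Rightarrow> ('v \<Rightarrow> 'v \<Rightarrow> real) \<Rightarrow> ('a \<Rightarrow> 'a \<Rightarrow> real) \<Rightarrow> ('v \<Rightarrow> 'a) \<Rightarrow> real" where
  "pair_sum V w D x = (\<Sum>i\<in>V. \<Sum>j\<in>V. w i j * D (x i) (x j))"

lemma pair_sum_split_independent:
  assumes "finite V" "C \<subseteq> V"
    and w_sym: "\<And>i j. w i j = w j i" and D_sym: "\<And>a b. D a b = D b a"
    and indep: "\<And>i j. i \<in> C \<Longrightarrow> j \<in> C \<Longrightarrow> w i j = 0"
  shows "pair_sum V w D x =
    pair_sum (V - C) w D x + 2 * (\<Sum>i\<in>C. \<Sum>j\<in>V - C. w i j * D (x i) (x j))"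
proof -
  have split: "(\<Sum>i\<in>V. h i) = (\<Sum>i\<in>V - C. h i) + (\<Sum>i\<in>C. h i)" for h :: "'a \<Rightarrow> real"
    by (rule sum.subset_diff[OF assms(2,1)])
  have "(\<Sum>i\<in>V - C. \<Sum>j\<in>C. w i j * D (x i) (x j)) = (\<Sum>i\<in>C. \<Sum>j\<in>V - C. w i j * D (x i) (x j))"
    by (subst sum.swap) (simp add: w_sym D_sym)
  moreover have "(\<Sum>i\<in>C. \<Sum>j\<in>C. w i j * D (x i) (x j)) = 0"
    by (simp add: indep)
  ultimately show ?thesis
    unfolding pair_sum_def by (simp add: split sum.distrib)
qed

text \<open>With the values off \<open>C\<close> fixed, every \<open>i \<in> C\<close> contributes \<open>g (x i)\<close> for one function \<open>g\<close>,
  the same for all of \<open>C\<close> since its members are twins. The member \<open>r\<close> is one that maximizes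
  \<open>g (x r)\<close>.\<close>

lemma merge_twin_set:
  assumes "finite V" "C \<subseteq> V" "C \<noteq> {}"
    and w_sym: "\<And>i j. w i j = w j i" and D_sym: "\<And>a b. D a b = D b a"
    and indep: "\<And>i j. i \<in> C \<Longrightarrow> j \<in> C \<Longrightarrow> w i j = 0"
    and twins: "\<And>i i' j. i \<in> C \<Longrightarrow> i' \<in> C \<Longrightarrow> j \<in> V - C \<Longrightarrow> w i j = w i' j"
  shows "\<exists>r\<in>C. pair_sum V w D x \<le> pair_sum V w D (\<lambda>i. if i \<in> C then x r else x i)"
proof -
  obtain c where c: "c \<in> C" using assms(3) by blast
  define g where "g a = (\<Sum>j\<in>V - C. w c j * D a (x j))" for a
  have fin: "finite C" using assms finite_subset by blast
  obtain r where r: "r \<in> C" "\<And>i. i \<in> C \<Longrightarrow> g (x i) \<le> g (x r)"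
  proof -
    have "Max ((\<lambda>i. g (x i)) ` C) \<in> (\<lambda>i. g (x i)) ` C"
      using fin assms(3) by (intro Max_in) auto
    then obtain r where "r \<in> C" "g (x r) = Max ((\<lambda>i. g (x i)) ` C)" by force
    with fin that show ?thesis by simp
  qed
  have contribution: "(\<Sum>j\<in>V - C. w i j * D a (x j)) = g a" if "i \<in> C" for i a
    unfolding g_def using twins[OF that c] by (intro sum.cong) auto
  define y where "y = (\<lambda>i. if i \<in> C then x r else x i)"
  have outside: "pair_sum (V - C) w D y = pair_sum (V - C) w D x"
    unfolding pair_sum_def y_def by (intro sum.cong) auto
  have "(\<Sum>i\<in>C. \<Sum>j\<in>V - C. w i j * D (x i) (x j)) = (\<Sum>i\<in>C. g (x i))"
    by (intro sum.cong) (simp_all add: contribution)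
  also have "\<dots> \<le> (\<Sum>i\<in>C. g (x r))"
    by (intro sum_mono r)
  also have "\<dots> = (\<Sum>i\<in>C. \<Sum>j\<in>V - C. w i j * D (y i) (y j))"
    unfolding y_def by (intro sum.cong) (simp_all flip: contribution)
  finally have "pair_sum V w D x \<le> pair_sum V w D y"
    using pair_sum_split_independent[OF assms(1,2) w_sym D_sym indep, where x = x]
      pair_sum_split_independent[OF assms(1,2) w_sym D_sym indep, where x = y] outside
    by simp
  with r(1) show ?thesis unfolding y_def by blast
qed

text \<open>Merging one class leaves the other classes untouched, so the classes can be treated in turn.
  The values of the new assignment are among the old ones; this is what preserves feasibility.\<close>

lemma merge_twin_classes:
  assumes "finite V"
    and w_sym: "\<And>i j. w i j = w j i" and D_sym: "\<And>a b. D a b = D b a"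
    and indep: "\<And>i j. i \<in> V \<Longrightarrow> j \<in> V \<Longrightarrow> c i = c j \<Longrightarrow> w i j = 0"
    and twins: "\<And>i i' j. i \<in> V \<Longrightarrow> i' \<in> V \<Longrightarrow> j \<in> V \<Longrightarrow> c i = c i' \<Longrightarrow> w i j = w i' j"
    and "finite S"
  shows "\<exists>y. y ` V \<subseteq> x ` V \<and> (\<forall>i\<in>V. \<forall>j\<in>V. c i = c j \<longrightarrow> c i \<in> S \<longrightarrow> y i = y j) \<and>
    pair_sum V w D x \<le> pair_sum V w D y"
  using \<open>finite S\<close>
proof (induction S)
  case empty
  show ?case by auto
next
  case (insert s S)
  then obtain y where y: "y ` V \<subseteq> x ` V" "pair_sum V w D x \<le> pair_sum V w D y"
    and const: "\<forall>i\<in>V. \<forall>j\<in>V. c i = c j \<longrightarrow> c i \<in> S \<longrightarrow> y i = y j"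
    by (elim exE conjE)
  define C where "C = {i \<in> V. c i = s}"
  show ?case
  proof (cases "C = {}")
    case True
    then have "\<forall>i\<in>V. \<forall>j\<in>V. c i = c j \<longrightarrow> c i \<in> insert s S \<longrightarrow> y i = y j"
      using const unfolding C_def by blast
    with y show ?thesis by blast
  next
    case False
    have "\<exists>r\<in>C. pair_sum V w D y \<le> pair_sum V w D (\<lambda>i. if i \<in> C then y r else y i)"
    proof (rule merge_twin_set[OF \<open>finite V\<close> _ False w_sym D_sym])
      show "C \<subseteq> V" by (auto simp: C_def)
    next
      fix i j assume "i \<in> C" "j \<in> C"
      then show "w i j = 0" using indep unfolding C_def by simp
    next
      fix i i' j assume "i \<in> C" "i' \<in> C" "j \<in> V - C"
      then show "w i j = w i' j" using twins[of i i' j] unfolding C_def by simp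
    qed
    then obtain r where r: "r \<in> C"
      "pair_sum V w D y \<le> pair_sum V w D (\<lambda>i. if i \<in> C then y r else y i)" by blast
    let ?z = "\<lambda>i. if i \<in> C then y r else y i"
    have "?z ` V \<subseteq> x ` V" using r(1) y(1) unfolding C_def by auto
    moreover have "\<forall>i\<in>V. \<forall>j\<in>V. c i = c j \<longrightarrow> c i \<in> insert s S \<longrightarrow> ?z i = ?z j"
    proof (intro ballI impI)
      fix i j assume "i \<in> V" "j \<in> V" "c i = c j" "c i \<in> insert s S"
      then show "?z i = ?z j"
        using const[rule_format, of i j] unfolding C_def by (cases "c j = s") simp_all
    qed
    moreover have "pair_sum V w D x \<le> pair_sum V w D ?z" using y(2) r(2) by linarith
    ultimately show ?thesis by blast
  qed
qed


section \<open>The objective as a sum over ordered pairs\<close>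

definition separation :: "nat \<Rightarrow> (nat \<Rightarrow> real) \<Rightarrow> (nat \<Rightarrow> real) \<Rightarrow> real" where
  "separation k a b = 1 - (\<Sum>l=1..k. a l * b l)"

lemma separation_commute: "separation k a b = separation k b a"
  by (simp add: separation_def mult.commute)

text \<open>The condition on non-edges includes \<open>i = j\<close>, so the diagonal of the double sum vanishes.\<close>

lemma twice_bqo_objective:
  assumes G: "simple_wgraph G"
    and nonedge: "\<And>i j. i \<in> {1..nvert G} \<Longrightarrow> j \<in> {1..nvert G} \<Longrightarrow> {i, j} \<notin> edges G \<Longrightarrow> weight G i j = 0"
  shows "2 * bqo_objective G k x = pair_sum {1..nvert G} (weight G) (separation k) x"
proof -
  let ?V = "{1..nvert G}"
  let ?h = "\<lambda>(i, j). weight G i j * separation k (x i) (x j)"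
  let ?E = "{(i, j). i < j \<and> {i, j} \<in> edges G}"
  have edge_ends: "i \<in> ?V \<and> j \<in> ?V \<and> i \<noteq> j" if "{i, j} \<in> edges G" for i j
  proof -
    have "{i, j} \<in> {{i, j} | i j. i \<in> ?V \<and> j \<in> ?V \<and> i \<noteq> j}"
      using G that unfolding simple_wgraph_def by blast
    then obtain a b where "{i, j} = {a, b}" "a \<in> ?V" "b \<in> ?V" "a \<noteq> b" by blast
    then show ?thesis by (auto simp: doubleton_eq_iff)
  qed
  have sub: "?E \<union> prod.swap ` ?E \<subseteq> ?V \<times> ?V"
    using edge_ends by fastforce
  have fin: "finite ?E" using sub by (intro finite_subset[of ?E "?V \<times> ?V"]) auto
  have "pair_sum ?V (weight G) (separation k) x = sum ?h (?V \<times> ?V)"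
    unfolding pair_sum_def by (simp add: sum.cartesian_product)
  also have "\<dots> = sum ?h (?E \<union> prod.swap ` ?E)"
  proof (rule sum.mono_neutral_right[OF _ sub])
    show "\<forall>e\<in>?V \<times> ?V - (?E \<union> prod.swap ` ?E). ?h e = 0"
    proof
      fix e assume "e \<in> ?V \<times> ?V - (?E \<union> prod.swap ` ?E)"
      then obtain i j where e_ij: "e = (i, j)"
        and ij: "i \<in> ?V" "j \<in> ?V" "(i, j) \<notin> ?E" "(i, j) \<notin> prod.swap ` ?E"
        by blast
      have "{i, j} \<notin> edges G"
      proof
        assume e: "{i, j} \<in> edges G"
        with ij(3) edge_ends[OF e] have "j < i" by simp
        with e have "(j, i) \<in> ?E" by (simp add: insert_commute)
        then have "prod.swap (j, i) \<in> prod.swap ` ?E" by (rule imageI)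
        with ij(4) show False by simp
      qed
      with ij nonedge show "?h e = 0" by (simp add: e_ij)
    qed
  qed simp
  also have "\<dots> = sum ?h ?E + sum ?h (prod.swap ` ?E)"
    by (rule sum.union_disjoint) (use fin in auto)
  also have "sum ?h (prod.swap ` ?E) = sum ?h ?E"
    using G by (subst sum.reindex)
      (auto intro!: sum.cong simp: simple_wgraph_def separation_commute)
  moreover have "bqo_objective G k x = sum ?h ?E"
    unfolding bqo_objective_def separation_def by (rule refl)
  ultimately show ?thesis by simp
qed


section \<open>Score classes and the reduced graph\<close>

lemma class_numbering_classes:
  assumes "class_numbering n R F M B"
  defines "P \<equiv> {1..card (score_classes n R F M)}"
  shows "(\<Union>p\<in>P. B p) = {1..n}"
    and "\<And>p q. p \<in> P \<Longrightarrow> q \<in> P \<Longrightarrow> p \<noteq> q \<Longrightarrow> B p \<inter> B q = {}"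
    and "\<And>p. p \<in> P \<Longrightarrow> B p \<noteq> {}"
    and "\<And>p i j. p \<in> P \<Longrightarrow> i \<in> B p \<Longrightarrow> j \<in> B p \<Longrightarrow> (R i, F i, M i) = (R j, F j, M j)"
proof -
  have bij: "bij_betw B P (score_classes n R F M)"
    using assms unfolding class_numbering_def by simp
  have classE: "\<exists>i\<in>{1..n}. B p = {j \<in> {1..n}. (R j, F j, M j) = (R i, F i, M i)}" if "p \<in> P" for p
  proof -
    have "B p \<in> score_classes n R F M" using bij_betwE[OF bij] that by blast
    then obtain s where "s \<in> (\<lambda>i. (R i, F i, M i)) ` {1..n}"
      "B p = {j \<in> {1..n}. (R j, F j, M j) = s}"
      unfolding score_classes_def by blast
    then show ?thesis by blast
  qed
  have "(\<Union>p\<in>P. B p) = \<Union> (score_classes n R F M)"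
    using bij_betw_imp_surj_on[OF bij] by blast
  also have "\<dots> = {1..n}" unfolding score_classes_def by blast
  finally show "(\<Union>p\<in>P. B p) = {1..n}" .
  show "B p \<noteq> {}" if "p \<in> P" for p
    using classE[OF that] by blast
  show "(R i, F i, M i) = (R j, F j, M j)" if "p \<in> P" "i \<in> B p" "j \<in> B p" for p i j
    using classE[OF that(1)] that(2,3) by auto
  show "B p \<inter> B q = {}" if "p \<in> P" "q \<in> P" "p \<noteq> q" for p q
  proof -
    have "B p \<noteq> B q" using bij_betw_imp_inj_on[OF bij] that by (auto dest: inj_onD)
    with classE[OF that(1)] classE[OF that(2)] show ?thesis by auto
  qed
qed

lemma sum_over_classes:
  fixes h :: "nat \<Rightarrow> real"
  assumes "class_numbering n R F M B"
  shows "(\<Sum>p=1..card (score_classes n R F M). \<Sum>i\<in>B p. h i) = (\<Sum>i=1..n. h i)"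
proof -
  note cl = class_numbering_classes[OF assms]
  have "finite (B p)" if "p \<in> {1..card (score_classes n R F M)}" for p
    by (rule finite_subset[of _ "{1..n}"]) (use cl(1) that in auto)
  then show ?thesis
    unfolding cl(1)[symmetric] using cl(2) by (intro sum.UNION_disjoint[symmetric]) blast+
qed

lemma twice_objective_customer:
  "2 * bqo_objective (customer_graph n R F M) k x =
    pair_sum {1..n} (weight (customer_graph n R F M)) (separation k) x"
proof -
  have "weight (customer_graph n R F M) i j = 0"
    if "i \<in> {1..n}" "j \<in> {1..n}" "{i, j} \<notin> edges (customer_graph n R F M)" for i j
  proof -
    have "(R i, F i, M i) = (R j, F j, M j)"
      using that unfolding customer_graph_def by (simp del: atLeastAtMost_iff)
    then show ?thesis by (simp add: customer_graph_def)
  qed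
  moreover have "nvert (customer_graph n R F M) = n" by (simp add: customer_graph_def)
  ultimately show ?thesis
    using twice_bqo_objective[OF simple_customer_graph, of n R F M k x] by simp
qed

lemma twice_objective_reduced:
  assumes "class_numbering n R F M B"
  defines "P \<equiv> {1..card (score_classes n R F M)}"
  shows "2 * bqo_objective (reduced_graph n R F M B) k y =
    pair_sum P (\<lambda>p q. \<Sum>i\<in>B p. \<Sum>j\<in>B q. weight (customer_graph n R F M) i j) (separation k) y"
proof -
  have "weight (reduced_graph n R F M B) p q = 0"
    if "p \<in> P" "q \<in> P" "{p, q} \<notin> edges (reduced_graph n R F M B)" for p q
  proof -
    have "p = q"
      using that unfolding reduced_graph_def Let_def P_def by (simp del: atLeastAtMost_iff)
    moreover have "weight (customer_graph n R F M) i j = 0" if "i \<in> B p" "j \<in> B p" for i j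
      using class_numbering_classes(4)[OF assms(1), of p i j] \<open>p \<in> P\<close> that
      unfolding P_def by (simp add: customer_graph_def)
    ultimately show ?thesis by (simp add: reduced_graph_def Let_def)
  qed
  moreover have "nvert (reduced_graph n R F M B) = card (score_classes n R F M)"
    by (simp add: reduced_graph_def Let_def)
  moreover have "weight (reduced_graph n R F M B) =
      (\<lambda>p q. \<Sum>i\<in>B p. \<Sum>j\<in>B q. weight (customer_graph n R F M) i j)"
    by (simp add: reduced_graph_def Let_def)
  ultimately show ?thesis
    using twice_bqo_objective[OF simple_reduced_graph, of n R F M B k y] by (simp add: P_def)
qed

text \<open>If \<open>x\<close> takes the value \<open>y p\<close> on the whole class \<open>B p\<close>, the separation of two customers is that
  of their classes and can be pulled out of each block of the double sum over the customers.\<close>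

lemma bqo_objective_reduced:
  assumes num: "class_numbering n R F M B"
    and xy: "\<And>p i. p \<in> {1..card (score_classes n R F M)} \<Longrightarrow> i \<in> B p \<Longrightarrow> x i = y p"
  shows "bqo_objective (reduced_graph n R F M B) k y = bqo_objective (customer_graph n R F M) k x"
proof -
  let ?P = "{1..card (score_classes n R F M)}"
  let ?w = "weight (customer_graph n R F M)"
  have "pair_sum ?P (\<lambda>p q. \<Sum>i\<in>B p. \<Sum>j\<in>B q. ?w i j) (separation k) y
      = (\<Sum>p\<in>?P. \<Sum>q\<in>?P. \<Sum>i\<in>B p. \<Sum>j\<in>B q. ?w i j * separation k (x i) (x j))"
    unfolding pair_sum_def sum_distrib_right by (intro sum.cong refl) (simp add: xy)
  also have "\<dots> = (\<Sum>p\<in>?P. \<Sum>i\<in>B p. \<Sum>q\<in>?P. \<Sum>j\<in>B q. ?w i j * separation k (x i) (x j))"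
    by (intro sum.cong refl sum.swap)
  also have "\<dots> = pair_sum {1..n} ?w (separation k) x"
    unfolding pair_sum_def by (simp only: sum_over_classes[OF num])
  finally show ?thesis
    using twice_objective_reduced[OF num, of k y] twice_objective_customer[of n R F M k x] by simp
qed


section \<open>Comparing the two optimal values\<close>

lemma bqo_feasible_rows:
  "bqo_feasible G k x \<longleftrightarrow>
    (\<forall>i\<in>{1..nvert G}. (\<Sum>l=1..k. x i l) = 1 \<and> (\<forall>l\<in>{1..k}. x i l \<in> {0, 1}))"
  unfolding bqo_feasible_def by blast

text \<open>Feasibility restricts each row separately, so it passes to any assignment all of whose rows are
  rows of a feasible one. This covers both spreading an assignment of the reduced graph over the
  classes and merging classes inside the customer graph.\<close>

lemma bqo_feasible_customer_rows:
  assumes "bqo_feasible G k y" and "x ` {1..n} \<subseteq> y ` {1..nvert G}"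
  shows "bqo_feasible (customer_graph n R F M) k x"
proof -
  have "(\<Sum>l=1..k. x i l) = 1 \<and> (\<forall>l\<in>{1..k}. x i l \<in> {0, 1})" if "i \<in> {1..n}" for i
  proof -
    have "x i \<in> y ` {1..nvert G}" using imageI[OF that] assms(2) by (rule rev_subsetD)
    then obtain p where "x i = y p" "p \<in> {1..nvert G}" by (rule imageE)
    then show ?thesis using bspec[OF assms(1)[unfolded bqo_feasible_rows]] by simp
  qed
  then show ?thesis unfolding bqo_feasible_rows by (simp add: customer_graph_def)
qed

lemma lift_to_customer_graph:
  assumes num: "class_numbering n R F M B"
    and y: "bqo_feasible (reduced_graph n R F M B) k y"
  shows "\<exists>x. bqo_feasible (customer_graph n R F M) k x \<and>
    bqo_objective (customer_graph n R F M) k x = bqo_objective (reduced_graph n R F M B) k y"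
proof -
  let ?P = "{1..card (score_classes n R F M)}"
  note cl = class_numbering_classes[OF num]
  define idx where "idx i = (THE p. p \<in> ?P \<and> i \<in> B p)" for i
  have idx: "idx i = p" if "p \<in> ?P" "i \<in> B p" for p i
    unfolding idx_def using that cl(2) by (intro the_equality) blast+
  have "idx i \<in> ?P" if i: "i \<in> {1..n}" for i
  proof -
    obtain p where p: "p \<in> ?P" "i \<in> B p"
      using i cl(1) by blast
    then show ?thesis using idx[OF p] by simp
  qed
  then have "bqo_feasible (customer_graph n R F M) k (\<lambda>i. y (idx i))"
    by (intro bqo_feasible_customer_rows[OF y]) (auto simp: reduced_graph_def Let_def)
  moreover have "bqo_objective (reduced_graph n R F M B) k y =
      bqo_objective (customer_graph n R F M) k (\<lambda>i. y (idx i))"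
    by (rule bqo_objective_reduced[OF num]) (simp only: idx)
  ultimately show ?thesis by metis
qed

text \<open>After merging all classes, any representative of a class can be used to read off the value of
  the corresponding vertex of the reduced graph.\<close>

lemma improve_to_reduced_graph:
  assumes num: "class_numbering n R F M B"
    and x: "bqo_feasible (customer_graph n R F M) k x"
  shows "\<exists>y. bqo_feasible (reduced_graph n R F M B) k y \<and>
    bqo_objective (customer_graph n R F M) k x \<le> bqo_objective (reduced_graph n R F M B) k y"
proof -
  let ?P = "{1..card (score_classes n R F M)}"
  let ?score = "\<lambda>i. (R i, F i, M i)"
  let ?w = "weight (customer_graph n R F M)"
  note cl = class_numbering_classes[OF num]
  have "\<exists>z. z ` {1..n} \<subseteq> x ` {1..n} \<and>
      (\<forall>i\<in>{1..n}. \<forall>j\<in>{1..n}. ?score i = ?score j \<longrightarrow> ?score i \<in> ?score ` {1..n} \<longrightarrow> z i = z j) \<and>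
      pair_sum {1..n} ?w (separation k) x \<le> pair_sum {1..n} ?w (separation k) z"
    by (rule merge_twin_classes) (auto simp: customer_graph_def separation_commute)
  then obtain z where z: "z ` {1..n} \<subseteq> x ` {1..n}"
    and const: "\<And>i j. i \<in> {1..n} \<Longrightarrow> j \<in> {1..n} \<Longrightarrow> ?score i = ?score j \<Longrightarrow> z i = z j"
    and le: "pair_sum {1..n} ?w (separation k) x \<le> pair_sum {1..n} ?w (separation k) z"
    by blast
  define rep where "rep p = (SOME i. i \<in> B p)" for p
  have rep: "rep p \<in> B p" if "p \<in> ?P" for p
    unfolding rep_def using cl(3)[OF that] by (simp add: some_in_eq)
  have class_sub: "i \<in> {1..n}" if "p \<in> ?P" "i \<in> B p" for p i
    using cl(1) that by blast
  have "z i = z (rep p)" if "p \<in> ?P" "i \<in> B p" for p i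
    using const class_sub cl(4) rep that by metis
  then have "bqo_objective (reduced_graph n R F M B) k (\<lambda>p. z (rep p)) =
      bqo_objective (customer_graph n R F M) k z"
    by (rule bqo_objective_reduced[OF num])
  moreover have "bqo_objective (customer_graph n R F M) k x \<le> bqo_objective (customer_graph n R F M) k z"
    using le twice_objective_customer[of n R F M k] by (metis mult_le_cancel_left_pos zero_less_numeral)
  moreover have "bqo_feasible (reduced_graph n R F M B) k (\<lambda>p. z (rep p))"
  proof -
    have "bqo_feasible (customer_graph n R F M) k z"
      by (rule bqo_feasible_customer_rows[OF x]) (use z in \<open>simp add: customer_graph_def\<close>)
    then show ?thesis
      using class_sub[OF _ rep] unfolding bqo_feasible_rows
      by (simp add: customer_graph_def reduced_graph_def Let_def)
  qed
  ultimately show ?thesis by (intro exI[of _ "\<lambda>p. z (rep p)"]) simp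
qed

theorem theorem2:
  fixes n T k :: nat
    and R F M :: "nat \<Rightarrow> nat"
    and B :: "nat \<Rightarrow> nat set"
    and x_opt xR_opt :: "nat \<Rightarrow> nat \<Rightarrow> real"
  assumes "n \<ge> 1" and "T \<ge> 1" and "k \<ge> 2"
    and scores: "\<And>i. i \<in> {1..n} \<Longrightarrow> (R i, F i, M i) \<in> {1..T} \<times> {1..T} \<times> {1..T}"
    and numbering: "class_numbering n R F M B"
    and "bqo_optimal (customer_graph n R F M) k x_opt"
    and "bqo_optimal (reduced_graph n R F M B) k xR_opt"
  shows "bqo_objective (customer_graph n R F M) k x_opt
       = bqo_objective (reduced_graph n R F M B) k xR_opt"
proof (rule antisym)
  show "bqo_objective (customer_graph n R F M) k x_opt
      \<le> bqo_objective (reduced_graph n R F M B) k xR_opt"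
    using improve_to_reduced_graph[OF numbering] assms(6,7)
    unfolding bqo_optimal_def by (meson order_trans)
next
  show "bqo_objective (reduced_graph n R F M B) k xR_opt
      \<le> bqo_objective (customer_graph n R F M) k x_opt"
    using lift_to_customer_graph[OF numbering] assms(6,7)
    unfolding bqo_optimal_def by metis
qed

end
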